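(* Let $\Sigma\in\mathbb{R}^{d\times d}$ be positive definite, let $X_1,\dots,X_n$ be i.i.d. $\mathcal{N}(0,\Sigma)$, $W=\sum_{i=1}^nX_iX_i^\top$, and assume $d>n+1$. Then $$\mathbb{E}\,\mathrm{Tr}(W^\dagger)\le\frac{n}{d}\,\frac{\mathrm{Tr}(\Sigma^{-1})}{d-n-1},$$ where $W^\dagger$ is the Moore–Penrose pseudoinverse of $W$. *)

theory Defs
  imports "HOL-Probability.Probability"
begin

definition pos_def_mat :: "real^'d^'d \<Rightarrow> bool" where
  "pos_def_mat S \<longleftrightarrow> transpose S = S \<and> (\<forall>x. x \<noteq> 0 \<longrightarrow> x \<bullet> (S *v x) > 0)"

definition mp_pinv :: "real^'n^'m \<Rightarrow> real^'m^'n" where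
  "mp_pinv A = (THE B. A ** B ** A = A \<and> B ** A ** B = B \<and>
      transpose (A ** B) = A ** B \<and> transpose (B ** A) = B ** A)"

definition outer :: "real^'d \<Rightarrow> real^'d \<Rightarrow> real^'d^'d" where
  "outer x y = (\<chi> i j. x $ i * y $ j)"

definition mvn_density :: "real^'d^'d \<Rightarrow> real^'d \<Rightarrow> ennreal" where
  "mvn_density S x = ennreal (exp (- (x \<bullet> (matrix_inv S *v x)) / 2)
       / sqrt ((2 * pi) ^ CARD('d) * det S))"

end

theory Submission
  imports Defs "HOL-Real_Asymp.Real_Asymp"
begin

text \<open>
Choose \<open>B\<close> with \<open>B \<Sigma> B\<^sup>T = I\<close>, so that \<open>\<Sigma>\<^sup>-\<^sup>1 = B\<^sup>T B\<close> and the vectors \<open>G\<^sub>i = B X\<^sub>i\<close> are i.i.d. standard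
Gaussian. Let \<open>z\<^sub>i\<close> be the component of \<open>G\<^sub>i\<close> orthogonal to the other \<open>G\<^sub>j\<close>. The vectors \<open>h\<^sub>i = z\<^sub>i / |z\<^sub>i|\<^sup>2\<close>
are dual to the \<open>G\<^sub>j\<close>, hence \<open>B\<^sup>T h\<^sub>i\<close> is dual to the \<open>X\<^sub>j\<close>. The trace of the pseudoinverse is the sum of
the squared lengths of the shortest dual system, so it is at most the sum of the \<open>|B\<^sup>T h\<^sub>i|\<^sup>2\<close>.
By orthogonal invariance \<open>E (h\<^sub>i \<bullet> u)\<^sup>2\<close> is the same for all unit vectors \<open>u\<close>, namely \<open>E |h\<^sub>i|\<^sup>2 / d\<close>;
summing over the columns of \<open>B\<close> produces \<open>Tr (\<Sigma>\<^sup>-\<^sup>1) E |h\<^sub>i|\<^sup>2 / d\<close>. Finally, given the other \<open>G\<^sub>j\<close>,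
\<open>|z\<^sub>i|\<^sup>2\<close> dominates a chi-square variable with \<open>k = d - n + 1\<close> degrees of freedom, whose reciprocal has mean
\<open>\<integral> (1 + 2 t) powr (-k/2) dt = 1 / (k - 2)\<close> over \<open>t \<ge> 0\<close> by the Laplace transform.
\<close>

section \<open>The trace of the pseudoinverse\<close>

lemma matrix_inv_eqI:
  assumes "A ** B = mat 1" "B ** A = mat 1"
  shows "matrix_inv A = B"
proof -
  have "A ** matrix_inv A = mat 1 \<and> matrix_inv A ** A = mat 1"
    unfolding matrix_inv_def by (rule someI[of _ B]) (use assms in auto)
  then show ?thesis by (metis assms(2) matrix_mul_assoc matrix_mul_lid matrix_mul_rid)
qed

lemma outer_mult_vec: "outer a b *v v = (b \<bullet> v) *\<^sub>R a"
  by (simp add: outer_def matrix_vector_mult_def inner_vec_def vec_eq_iff sum_distrib_left mult_ac)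

lemma trace_outer: "trace (outer a b) = a \<bullet> b"
  by (simp add: trace_def outer_def inner_vec_def)

lemma transpose_outer: "transpose (outer a b) = outer b a"
  by (simp add: transpose_def outer_def vec_eq_iff mult.commute)

lemma sum_mat_mult_vec: "(\<Sum>i\<in>I. A i) *v (v :: real^'n) = (\<Sum>i\<in>I. A i *v v)"
  by (induction I rule: infinite_finite_induct) (auto simp: matrix_vector_mult_add_rdistrib)

lemma transpose_sum: "transpose (\<Sum>i\<in>I. A i) = (\<Sum>i\<in>I. transpose (A i))"
  by (simp add: transpose_def vec_eq_iff)

lemma trace_sum: "trace (\<Sum>i\<in>I. A i) = (\<Sum>i\<in>I. trace (A i))"
  unfolding trace_def by (simp add: sum.swap[of _ I])

text \<open>Two solutions of the Penrose equations have equal products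
  \<open>A ** B = A ** C\<close> and \<open>B ** A = C ** A\<close>, because each product absorbs
  the other and symmetry lets the factors swap. Then
  \<open>C = C ** A ** C = C ** A ** B = B ** A ** B = B\<close>.\<close>

lemma mp_pinv_eqI:
  fixes A :: "real^'n^'m"
  assumes "A ** B ** A = A" "B ** A ** B = B"
    and "transpose (A ** B) = A ** B" "transpose (B ** A) = B ** A"
  shows "mp_pinv A = B"
  unfolding mp_pinv_def
proof (rule the_equality)
  fix C assume "A ** C ** A = A \<and> C ** A ** C = C \<and>
    transpose (A ** C) = A ** C \<and> transpose (C ** A) = C ** A"
  then have C: "A ** C ** A = A" "C ** A ** C = C"
    "transpose (A ** C) = A ** C" "transpose (C ** A) = C ** A" by auto
  have AB: "A ** B = A ** C"
  proof -
    have "A ** B = transpose (A ** B)" by (simp add: assms)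
    also have "\<dots> = transpose ((A ** C) ** (A ** B))"
      by (simp only: matrix_mul_assoc C(1))
    also have "\<dots> = (A ** B) ** (A ** C)"
      by (simp only: matrix_transpose_mul[of "A ** C"] assms C)
    also have "\<dots> = A ** C" by (simp only: matrix_mul_assoc assms(1))
    finally show ?thesis .
  qed
  have BA: "B ** A = C ** A"
  proof -
    have "B ** A = transpose (B ** A)" by (simp add: assms)
    also have "\<dots> = transpose ((B ** A) ** (C ** A))"
      by (metis C(1) matrix_mul_assoc)
    also have "\<dots> = (C ** A) ** (B ** A)"
      by (simp only: matrix_transpose_mul[of "B ** A"] assms C)
    also have "\<dots> = C ** A" by (metis assms(1) matrix_mul_assoc)
    finally show ?thesis .
  qed
  show "C = B"
    by (metis AB BA C(2) assms(2) matrix_mul_assoc)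
qed (use assms in auto)

text \<open>Projecting a dual system \<open>w\<close> onto the span of the \<open>x i\<close> keeps
  it dual and shortens it. The projected system \<open>y\<close> gives the pseudoinverse explicitly,
  as the sum of the \<open>outer (y i) (y i)\<close>.\<close>

lemma trace_mp_pinv_gram_le:
  fixes x w :: "nat \<Rightarrow> real^'d"
  assumes dual: "\<And>i j. i < n \<Longrightarrow> j < n \<Longrightarrow> w i \<bullet> x j = (if i = j then 1 else 0)"
  shows "trace (mp_pinv (\<Sum>i<n. outer (x i) (x i))) \<le> (\<Sum>i<n. w i \<bullet> w i)"
proof -
  define S where "S = span (x ` {..<n})"
  have xS: "x i \<in> S" if "i < n" for i using that by (auto simp: S_def intro: span_base)
  have "\<exists>y z. y \<in> S \<and> (\<forall>s\<in>S. z \<bullet> s = 0) \<and> w i = y + z" for i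
    using orthogonal_subspace_decomp_exists[of "x ` {..<n}" "w i"]
    unfolding S_def orthogonal_def by metis
  then obtain y z where yS: "\<And>i. y i \<in> S" and z: "\<And>i s. s \<in> S \<Longrightarrow> z i \<bullet> s = 0"
    and w: "\<And>i. w i = y i + z i" by metis
  have yx: "y i \<bullet> x j = (if i = j then 1 else 0)" if "i < n" "j < n" for i j
    using dual[OF that] z[OF xS[OF that(2)], of i] by (simp add: w inner_add_left)
  define W where "W = (\<Sum>i<n. outer (x i) (x i))"
  define B where "B = (\<Sum>i<n. outer (y i) (y i))"
  \<comment> \<open>\<open>K\<close> will turn out to be the orthogonal projection onto
    \<open>S\<close>; it equals \<open>W ** B\<close>, so the symmetry conditions of Penrose reduce
    to the symmetry of \<open>K\<close>.\<close>
  define K where "K = (\<Sum>i<n. outer (x i) (y i))"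
  have Wv: "W *v v = (\<Sum>i<n. (x i \<bullet> v) *\<^sub>R x i)" for v
    by (simp add: W_def sum_mat_mult_vec outer_mult_vec)
  have Bv: "B *v v = (\<Sum>i<n. (y i \<bullet> v) *\<^sub>R y i)" for v
    by (simp add: B_def sum_mat_mult_vec outer_mult_vec)
  have Kv: "K *v v = (\<Sum>i<n. (y i \<bullet> v) *\<^sub>R x i)" for v
    by (simp add: K_def sum_mat_mult_vec outer_mult_vec)
  have Ktv: "transpose K *v v = (\<Sum>i<n. (x i \<bullet> v) *\<^sub>R y i)" for v
    by (simp add: K_def transpose_sum transpose_outer sum_mat_mult_vec outer_mult_vec)
  have pick: "(\<Sum>i<n. c i * (if i = j then 1 else 0)) = c j" if "j < n" for j and c :: "nat \<Rightarrow> real"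
    using that by (simp add: if_distrib cong: if_cong)
  have pick': "(\<Sum>i<n. c i * (if j = i then 1 else 0)) = c j" if "j < n" for j and c :: "nat \<Rightarrow> real"
    using that by (simp add: if_distrib cong: if_cong)
  have yK: "y j \<bullet> (\<Sum>i<n. c i *\<^sub>R x i) = c j" if "j < n" for j c
  proof -
    have "y j \<bullet> (\<Sum>i<n. c i *\<^sub>R x i) = (\<Sum>i<n. c i * (if j = i then 1 else 0))"
      unfolding inner_sum_right inner_scaleR_right using that by (intro sum.cong) (auto simp: yx)
    then show ?thesis using pick'[OF that] by simp
  qed
  have xK: "x j \<bullet> (\<Sum>i<n. c i *\<^sub>R y i) = c j" if "j < n" for j c
  proof -
    have "x j \<bullet> (\<Sum>i<n. c i *\<^sub>R y i) = (\<Sum>i<n. c i * (if i = j then 1 else 0))"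
      unfolding inner_sum_right inner_scaleR_right using that
      by (intro sum.cong) (auto simp: yx inner_commute[of "x j"])
    then show ?thesis using pick[OF that] by simp
  qed
  have WB: "W ** B = K"
    unfolding matrix_eq by (auto simp: matrix_vector_mul_assoc[symmetric] Wv Bv Kv xK intro!: sum.cong)
  have BW: "B ** W = transpose K"
    unfolding matrix_eq by (auto simp: matrix_vector_mul_assoc[symmetric] Wv Bv Ktv yK simp del: transpose_matrix_vector intro!: sum.cong)
  have KW: "K ** W = W"
    unfolding matrix_eq by (auto simp: matrix_vector_mul_assoc[symmetric] Wv Kv yK intro!: sum.cong)
  have KB: "transpose K ** B = B"
    unfolding matrix_eq by (auto simp: matrix_vector_mul_assoc[symmetric] Bv Ktv xK simp del: transpose_matrix_vector intro!: sum.cong)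
  have Kid: "K *v s = s" if "s \<in> S" for s
    using that unfolding S_def
  proof (induction rule: span_induct)
    case base
    show ?case by (auto simp: subspace_def matrix_vector_right_distrib scaleR_matrix_vector_assoc[symmetric] matrix_vector_mult_scaleR)
  next
    case (step s)
    then obtain j where j: "j < n" "s = x j" by auto
    have "K *v x j = (\<Sum>i<n. (if i = j then 1 else 0) *\<^sub>R x i)"
      unfolding Kv using j by (intro sum.cong) (auto simp: yx)
    also have "\<dots> = (\<Sum>i<n. if i = j then x i else 0)" by (intro sum.cong) auto
    finally show ?case using j by simp
  qed
  \<comment> \<open>The vector \<open>transpose K *v v\<close> lies in \<open>S\<close> and differs
    from \<open>v\<close> by something orthogonal to \<open>S\<close>. \<open>K\<close> kills that
    difference, since it pairs only with the \<open>y i\<close> in \<open>S\<close>, and it fixes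
    \<open>S\<close>.\<close>
  have "K *v v = transpose K *v v" for v
  proof -
    let ?t = "transpose K *v v"
    have tS: "?t \<in> S" unfolding Ktv S_def
      by (intro span_sum span_scale yS[unfolded S_def])
    have orth: "s \<bullet> (v - ?t) = 0" if "s \<in> S" for s
      using that unfolding S_def
    proof (induction rule: span_induct)
      case base
      show ?case by (auto simp: subspace_def inner_add_left)
    next
      case (step s)
      then show ?case by (auto simp: Ktv inner_diff_right xK simp del: transpose_matrix_vector)
    qed
    have "K *v (v - ?t) = 0"
      unfolding Kv using orth[OF yS] by simp
    then show ?thesis
      using Kid[OF tS] by (simp add: matrix_vector_mult_diff_distrib)
  qed
  then have Ksym: "transpose K = K" by (simp add: matrix_eq)
  have "mp_pinv W = B"
    by (rule mp_pinv_eqI) (simp_all add: WB BW KW Ksym KB[unfolded Ksym])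
  moreover have "trace B = (\<Sum>i<n. y i \<bullet> y i)"
    by (simp add: B_def trace_sum trace_outer)
  moreover have "y i \<bullet> y i \<le> w i \<bullet> w i" for i
    using z[OF yS, of i i] by (simp add: w inner_add_left inner_add_right inner_commute)
  ultimately show ?thesis
    unfolding W_def by (simp add: sum_mono)
qed

section \<open>Orthogonal components and dual vectors\<close>

text \<open>Explicit Gram--Schmidt recursion rather than an abstract projection, so that joint
measurability in all arguments is evident; division by zero makes it correct for dependent lists too.\<close>

fun perp_part :: "'a::real_inner list \<Rightarrow> 'a \<Rightarrow> 'a" where
  "perp_part [] u = u"
| "perp_part (v # vs) u =
    perp_part vs u - ((perp_part vs u \<bullet> perp_part vs v) / (perp_part vs v \<bullet> perp_part vs v)) *\<^sub>R perp_part vs v"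

text \<open>With \<open>perp_part_orthogonal\<close>, this identifies \<open>perp_part vs u\<close>
  as the component of \<open>u\<close> orthogonal to the span of \<open>vs\<close>.\<close>

lemma diff_perp_part_in_span: "u - perp_part vs u \<in> span (set vs)"
proof (induction vs arbitrary: u)
  case (Cons v vs)
  have sub: "span (set vs) \<subseteq> span (set (v # vs))" by (intro span_mono) auto
  have "v - (v - perp_part vs v) \<in> span (set (v # vs))"
    by (intro span_diff subsetD[OF sub Cons.IH] span_base) simp
  then have "perp_part vs v \<in> span (set (v # vs))" by simp
  moreover have "u - perp_part vs u \<in> span (set (v # vs))" using sub Cons by blast
  ultimately have *: "(u - perp_part vs u) + c *\<^sub>R perp_part vs v \<in> span (set (v # vs))" for c
    by (intro span_add span_scale)
  have "a - (p - q) = (a - p) + q" for a p q :: 'a by simp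
  then show ?case unfolding perp_part.simps by (simp only: *)
qed (simp add: span_zero)

lemma inner_span_eq_0: "(\<And>v. v \<in> S \<Longrightarrow> z \<bullet> v = 0) \<Longrightarrow> s \<in> span S \<Longrightarrow> z \<bullet> s = 0"
  using orthogonal_to_span[of s S z] by (simp add: orthogonal_def)

lemma perp_part_inner_eq:
  assumes "\<And>v. v \<in> set vs \<Longrightarrow> u' \<bullet> v = 0"
  shows "u' \<bullet> perp_part vs u = u' \<bullet> u"
  using inner_span_eq_0[OF assms diff_perp_part_in_span[of u vs]] by (simp add: inner_diff_right)

text \<open>For the new vector \<open>v\<close>, pairing with \<open>v\<close> agrees with pairing
  with \<open>perp_part vs v\<close>, so the subtracted multiple cancels exactly. If
  \<open>perp_part vs v\<close> is 0, the pairing with \<open>v\<close> vanishes already and the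
  division by zero drops the correction.\<close>

lemma perp_part_orthogonal: "x \<in> set vs \<Longrightarrow> perp_part vs u \<bullet> x = 0"
proof (induction vs arbitrary: u x)
  case (Cons v vs)
  let ?w = "perp_part vs v"
  have "perp_part vs a \<bullet> v = perp_part vs a \<bullet> ?w" for a
    by (rule perp_part_inner_eq[symmetric]) (rule Cons.IH)
  then show ?case using Cons by (auto simp: inner_diff_left)
qed simp

text \<open>The recursion uses only linear operations and inner products, and an orthogonal map
  preserves both.\<close>

lemma perp_part_map:
  assumes f: "orthogonal_transformation f"
  shows "perp_part (map f vs) (f u) = f (perp_part vs u)"
proof (induction vs arbitrary: u)
  case (Cons v vs)
  have "linear f" and inner: "f a \<bullet> f b = a \<bullet> b" for a b
    using f by (auto simp: orthogonal_transformation_def)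
  then show ?case
    by (simp only: list.map perp_part.simps Cons.IH inner linear_diff linear_scale)
qed simp

lemma borel_measurable_perp_part:
  fixes g :: "'i \<Rightarrow> 'w \<Rightarrow> 'a::euclidean_space"
  assumes "\<And>j. j \<in> set js \<Longrightarrow> g j \<in> borel_measurable M" "f \<in> borel_measurable M"
  shows "(\<lambda>\<omega>. perp_part (map (\<lambda>j. g j \<omega>) js) (f \<omega>)) \<in> borel_measurable M"
  using assms
proof (induction js arbitrary: f)
  case (Cons j js)
  have "(\<lambda>\<omega>. perp_part (map (\<lambda>j. g j \<omega>) js) (f \<omega>)) \<in> borel_measurable M"
    "(\<lambda>\<omega>. perp_part (map (\<lambda>j. g j \<omega>) js) (g j \<omega>)) \<in> borel_measurable M"
    by (rule Cons.IH; use Cons.prems in simp)+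
  then show ?case
    unfolding list.map perp_part.simps
    by (intro borel_measurable_diff borel_measurable_scaleR borel_measurable_divide
        borel_measurable_inner)
qed simp

definition dual_vec :: "'a::real_inner list \<Rightarrow> 'a \<Rightarrow> 'a" where
  "dual_vec vs u = (1 / (perp_part vs u \<bullet> perp_part vs u)) *\<^sub>R perp_part vs u"

lemma dual_vec_orthogonal: "x \<in> set vs \<Longrightarrow> dual_vec vs u \<bullet> x = 0"
  by (simp add: dual_vec_def perp_part_orthogonal)

lemma dual_vec_inner_self:
  assumes "perp_part vs u \<noteq> 0"
  shows "dual_vec vs u \<bullet> u = 1"
proof -
  have "perp_part vs u \<bullet> perp_part vs u = perp_part vs u \<bullet> u"
    by (rule perp_part_inner_eq) (rule perp_part_orthogonal)
  then show ?thesis using assms by (simp add: dual_vec_def) (metis inner_eq_zero_iff)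
qed

lemma dual_vec_map:
  "orthogonal_transformation f \<Longrightarrow> dual_vec (map f vs) (f u) = f (dual_vec vs u)"
  by (simp add: dual_vec_def perp_part_map orthogonal_transformation_def linear_scale)

text \<open>Equality holds for a nonzero orthogonal component. In the degenerate case the left side
  is 0 and the right side is infinite.\<close>

lemma inner_dual_vec_le:
  "ennreal (dual_vec vs u \<bullet> dual_vec vs u) \<le> inverse (ennreal (perp_part vs u \<bullet> perp_part vs u))"
proof (cases "perp_part vs u = 0")
  case False
  then have "perp_part vs u \<bullet> perp_part vs u > 0" by simp
  then show ?thesis by (simp add: dual_vec_def inverse_ennreal divide_simps)
qed simp

section \<open>Orthonormal frames\<close>

text \<open>The orthogonal complement of \<open>T\<close> has codimension at most
  \<open>card T\<close>, so it meets \<open>W\<close> in dimension at least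
  \<open>dim W - card T\<close>, which is positive.\<close>

lemma orthogonal_vector_exists:
  fixes T W :: "'a::euclidean_space set"
  assumes "finite T" "subspace W" "card T < dim W"
  shows "\<exists>v\<in>W. v \<noteq> 0 \<and> (\<forall>t\<in>T. t \<bullet> v = 0)"
proof -
  define U where "U = {v. \<forall>t\<in>span T. orthogonal t v}"
  have U: "subspace U"
    by (auto simp: U_def subspace_def orthogonal_def inner_add_right)
  have "dim U + dim (span T) = DIM('a)"
    using dim_subspace_orthogonal_to_vectors[of "span T" UNIV] by (simp add: U_def)
  moreover have "dim (span T) \<le> card T"
    using assms(1) by (simp add: dim_le_card')
  moreover have "dim {x + y |x y. x \<in> W \<and> y \<in> U} + dim (W \<inter> U) = dim W + dim U"
    by (rule dim_sums_Int[OF assms(2) U])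
  moreover have "dim {x + y |x y. x \<in> W \<and> y \<in> U} \<le> DIM('a)" by (rule dim_subset_UNIV)
  ultimately have "dim (W \<inter> U) \<noteq> 0" using assms(3) by linarith
  then obtain v where "v \<in> W \<inter> U" "v \<noteq> 0" by (auto simp: dim_eq_0)
  then show ?thesis by (auto simp: U_def orthogonal_def intro: span_base)
qed

text \<open>Gram--Schmidt for the inner product given by \<open>S\<close>: the vectors indexed by
  \<open>K\<close> are kept and those indexed by \<open>L\<close> are found in \<open>W\<close>. It
  serves both to whiten a covariance matrix and, with \<open>S\<close> the identity, to build
  orthogonal matrices with prescribed rows.\<close>

lemma orthonormal_frame_extend:
  fixes S :: "real^'d^'d" and b :: "'i \<Rightarrow> real^'d"
  assumes S: "pos_def_mat S" and W: "subspace W" and K: "finite K" "finite L" "K \<inter> L = {}"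
    and card: "card (K \<union> L) \<le> dim W"
    and b: "\<And>i j. i \<in> K \<Longrightarrow> j \<in> K \<Longrightarrow> b i \<bullet> (S *v b j) = (if i = j then 1 else 0)"
  shows "\<exists>b'. (\<forall>i\<in>K. b' i = b i) \<and> (\<forall>i\<in>L. b' i \<in> W) \<and>
    (\<forall>i\<in>K \<union> L. \<forall>j\<in>K \<union> L. b' i \<bullet> (S *v b' j) = (if i = j then 1 else 0))"
  using K(2,3) card
proof (induction L rule: finite_induct)
  case empty
  then show ?case using b by auto
next
  case (insert l L)
  have l: "l \<notin> K \<union> L" and KL: "K \<inter> L = {}" using insert.hyps insert.prems by blast+
  have fin: "finite (K \<union> L)" using K(1) insert.hyps by simp
  have "card (K \<union> insert l L) = Suc (card (K \<union> L))" using l fin by simp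
  then have cardless: "card (K \<union> L) < dim W"
    using insert.prems by linarith
  from insert.IH[OF KL less_imp_le[OF cardless]] obtain b' where
    b': "\<forall>i\<in>K. b' i = b i" "\<forall>i\<in>L. b' i \<in> W"
    and ortho: "\<forall>i\<in>K \<union> L. \<forall>j\<in>K \<union> L. b' i \<bullet> (S *v b' j) = (if i = j then 1 else 0)"
    by blast
  \<comment> \<open>Orthogonality with respect to \<open>S\<close> is ordinary orthogonality to the
    images \<open>S *v b' i\<close>, which are fewer than \<open>dim W\<close>.\<close>
  have "card ((\<lambda>i. S *v b' i) ` (K \<union> L)) < dim W"
    using cardless card_image_le[OF fin, of "\<lambda>i. S *v b' i"] by linarith
  from orthogonal_vector_exists[OF finite_imageI[OF fin] W this]
  obtain v where v: "v \<in> W" "v \<noteq> 0" "\<And>i. i \<in> K \<union> L \<Longrightarrow> (S *v b' i) \<bullet> v = 0"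
    by blast
  have sym: "a \<bullet> (S *v c) = (S *v a) \<bullet> c" for a c
    using S dot_lmul_matrix[of a S c] by (metis pos_def_mat_def vector_transpose_matrix)
  have pos: "v \<bullet> (S *v v) > 0" using S v by (auto simp: pos_def_mat_def)
  define r where "r = sqrt (v \<bullet> (S *v v))"
  have r: "r > 0" "r * r = v \<bullet> (S *v v)" using pos by (auto simp: r_def)
  define e where "e = (1 / r) *\<^sub>R v"
  have e: "e \<in> W" "e \<bullet> (S *v e) = 1" "\<And>i. i \<in> K \<union> L \<Longrightarrow> (S *v b' i) \<bullet> e = 0"
    using v r W pos by (simp_all add: e_def subspace_scale matrix_vector_mult_scaleR)
  have e2: "\<And>i. i \<in> K \<union> L \<Longrightarrow> e \<bullet> (S *v b' i) = 0" "\<And>i. i \<in> K \<union> L \<Longrightarrow> b' i \<bullet> (S *v e) = 0"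
    using e(3) by (simp_all only: inner_commute[of e] sym[of "b' _" e])
  show ?case
  proof (intro exI[of _ "b'(l := e)"] conjI ballI)
    fix i j assume ij: "i \<in> K \<union> insert l L" "j \<in> K \<union> insert l L"
    show "(b'(l := e)) i \<bullet> (S *v (b'(l := e)) j) = (if i = j then 1 else 0)"
    proof (cases "i = l"; cases "j = l")
      assume "i = l" "j = l"
      then show ?thesis by (metis fun_upd_apply e(2))
    next
      assume *: "i = l" "j \<noteq> l"
      then have "j \<in> K \<union> L" using ij by blast
      from e2(1)[OF this] show ?thesis using * by (metis fun_upd_apply)
    next
      assume *: "i \<noteq> l" "j = l"
      then have "i \<in> K \<union> L" using ij by blast
      from e2(2)[OF this] show ?thesis using * by (metis fun_upd_apply)
    next
      assume *: "i \<noteq> l" "j \<noteq> l"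
      then have "i \<in> K \<union> L" "j \<in> K \<union> L" using ij by blast+
      from ortho[rule_format, OF this] show ?thesis using * by (metis fun_upd_apply)
    qed
  next
    fix i assume "i \<in> K"
    then show "(b'(l := e)) i = b i" using b'(1) l by (metis UnI1 fun_upd_other)
  next
    fix i assume "i \<in> insert l L"
    then show "(b'(l := e)) i \<in> W" using b'(2) e(1) by (metis fun_upd_apply insertE)
  qed
qed

lemma pos_def_mat_frame:
  fixes S :: "real^'d^'d"
  assumes "pos_def_mat S"
  obtains B :: "real^'d^'d" where "B ** S ** transpose B = mat 1"
proof -
  obtain b :: "'d \<Rightarrow> real^'d" where b: "\<And>i j. b i \<bullet> (S *v b j) = (if i = j then 1 else 0)"
    using orthonormal_frame_extend[OF assms subspace_UNIV finite.emptyI finite, of UNIV "\<lambda>_::'d. 0"]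
    by (auto simp: dim_UNIV)
  define B where "B = (\<chi> i. b i)"
  have "(B ** S ** transpose B) $ i $ j = b i \<bullet> (S *v b j)" for i j
    unfolding matrix_mul_assoc[symmetric]
    by (simp add: matrix_matrix_mult_def matrix_vector_mult_def inner_vec_def B_def transpose_def)
  then have "B ** S ** transpose B = mat 1" by (simp add: vec_eq_iff mat_def b)
  then show ?thesis by (rule that)
qed

lemma pos_def_mat_1: "pos_def_mat (mat 1)"
  by (simp add: pos_def_mat_def transpose_mat)

text \<open>The frame is built twice: first inside \<open>W\<close> for the indices in
  \<open>K\<close>, then in the whole space for the remaining indices.\<close>

lemma orthogonal_matrix_rows_in_subspace:
  fixes W :: "(real^'d) set" and K :: "'d set"
  assumes W: "subspace W" "card K \<le> dim W"
  obtains Q :: "real^'d^'d" where "orthogonal_matrix Q" "\<And>i. i \<in> K \<Longrightarrow> Q $ i \<in> W"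
proof -
  obtain b :: "'d \<Rightarrow> real^'d" where b: "\<And>i. i \<in> K \<Longrightarrow> b i \<in> W"
     "\<And>i j. i \<in> K \<Longrightarrow> j \<in> K \<Longrightarrow> b i \<bullet> (mat 1 *v b j) = (if i = j then 1 else 0)"
    using orthonormal_frame_extend[OF pos_def_mat_1 W(1) finite.emptyI, of K "\<lambda>_::'d. 0"] W(2)
    by auto
  obtain c :: "'d \<Rightarrow> real^'d" where c: "\<And>i. i \<in> K \<Longrightarrow> c i = b i"
     "\<And>i j. c i \<bullet> (mat 1 *v c j) = (if i = j then 1 else 0)"
    using orthonormal_frame_extend[OF pos_def_mat_1 subspace_UNIV, of K "- K" b] b(2)
    by (auto simp: dim_UNIV)
  define Q where "Q = (\<chi> i. c i)"
  have "(Q ** transpose Q) $ i $ j = c i \<bullet> c j" for i j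
    by (simp add: matrix_matrix_mult_def inner_vec_def Q_def transpose_def)
  then have "Q ** transpose Q = mat 1" using c(2)[unfolded matrix_vector_mul_lid] by (simp add: vec_eq_iff mat_def)
  then have "orthogonal_matrix Q"
    unfolding orthogonal_matrix_def using matrix_left_right_inverse by blast
  with that[of Q] show ?thesis using b(1) c(1) by (simp add: Q_def)
qed

section \<open>Linear images of the standard Gaussian measure\<close>

text \<open>The change-of-variables theorems of the library need a well-ordered index type;
Haar uniqueness replaces them.\<close>

lemma nn_integral_lborel_shift:
  fixes f :: "'a::euclidean_space \<Rightarrow> ennreal"
  assumes [measurable]: "f \<in> borel_measurable borel" and c: "\<bar>c\<bar> = 1"
  shows "(\<integral>\<^sup>+x. f (t + c *\<^sub>R x) \<partial>lborel) = integral\<^sup>N lborel f"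
proof -
  have "c \<noteq> 0" using c by auto
  have "integral\<^sup>N lborel f = integral\<^sup>N (density (distr lborel borel (\<lambda>x. t + c *\<^sub>R x)) (\<lambda>_. \<bar>c\<bar>^DIM('a))) f"
    by (simp only: lborel_affine[OF \<open>c \<noteq> 0\<close>, of t, symmetric])
  also have "\<dots> = (\<integral>\<^sup>+x. f (t + c *\<^sub>R x) \<partial>lborel)"
    by (simp add: nn_integral_density nn_integral_distr c)
  finally show ?thesis ..
qed

text \<open>Uniqueness of Haar measure: integrate \<open>f x * indicator (box 0 One) (x + y)\<close> in both orders.\<close>

lemma nn_integral_translation_invariant:
  fixes \<mu> :: "'a::euclidean_space measure"
  assumes sets [measurable_cong]: "sets \<mu> = sets borel" and sf: "sigma_finite_measure \<mu>"
    and inv: "\<And>h a. h \<in> borel_measurable borel \<Longrightarrow> (\<integral>\<^sup>+x. h (x + a) \<partial>\<mu>) = integral\<^sup>N \<mu> h"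
    and f [measurable]: "f \<in> borel_measurable borel"
  shows "integral\<^sup>N \<mu> f = emeasure \<mu> (box 0 One) * integral\<^sup>N lborel f"
proof -
  interpret sigma_finite_measure \<mu> by fact
  interpret pair_sigma_finite lborel \<mu> ..
  let ?g = "indicator (box 0 One) :: 'a \<Rightarrow> ennreal"
  have g: "(\<integral>\<^sup>+y. ?g (x + y) \<partial>lborel) = 1" for x
  proof -
    have "(\<integral>\<^sup>+y. ?g (x + 1 *\<^sub>R y) \<partial>lborel) = integral\<^sup>N lborel ?g"
      by (rule nn_integral_lborel_shift) auto
    then show ?thesis by (simp add: emeasure_lborel_box_eq)
  qed
  have "integral\<^sup>N \<mu> f = (\<integral>\<^sup>+x. f x * (\<integral>\<^sup>+y. ?g (x + y) \<partial>lborel) \<partial>\<mu>)" by (simp add: g)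
  also have "\<dots> = (\<integral>\<^sup>+x. (\<integral>\<^sup>+y. f x * ?g (x + y) \<partial>lborel) \<partial>\<mu>)"
    by (subst nn_integral_cmult) auto
  also have "\<dots> = (\<integral>\<^sup>+y. (\<integral>\<^sup>+x. f x * ?g (x + y) \<partial>\<mu>) \<partial>lborel)"
    by (rule Fubini') simp
  also have "\<dots> = (\<integral>\<^sup>+y. (\<integral>\<^sup>+x. f (x - y) * ?g x \<partial>\<mu>) \<partial>lborel)"
  proof (rule nn_integral_cong)
    fix y
    show "(\<integral>\<^sup>+x. f x * ?g (x + y) \<partial>\<mu>) = (\<integral>\<^sup>+x. f (x - y) * ?g x \<partial>\<mu>)"
      using inv[of "\<lambda>x. f (x - y) * ?g x" y] by simp
  qed
  also have "\<dots> = (\<integral>\<^sup>+x. (\<integral>\<^sup>+y. f (x - y) * ?g x \<partial>lborel) \<partial>\<mu>)"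
    by (rule Fubini'[symmetric]) simp
  also have "\<dots> = (\<integral>\<^sup>+x. (\<integral>\<^sup>+y. f (x - y) \<partial>lborel) * ?g x \<partial>\<mu>)"
    by (subst nn_integral_multc) auto
  \<comment> \<open>For fixed \<open>x\<close>, the map from \<open>y\<close> to
    \<open>x - y\<close> is a reflection followed by a translation, which is the case
    \<open>c = -1\<close>.\<close>
  also have "\<dots> = (\<integral>\<^sup>+x. integral\<^sup>N lborel f * ?g x \<partial>\<mu>)"
    using nn_integral_lborel_shift[OF f, of "-1"] by simp
  also have "\<dots> = integral\<^sup>N lborel f * emeasure \<mu> (box 0 One)"
    by (subst nn_integral_cmult) (auto simp: sets)
  finally show ?thesis by (simp add: mult.commute)
qed

lemma borel_measurable_matrix_vector_mult [measurable]:
  "(*v) (A :: real^'n^'m) \<in> borel_measurable borel"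
  by (intro borel_measurable_continuous_onI matrix_vector_mult_linear_continuous_on)

text \<open>The image of Lebesgue measure under \<open>B\<close> is translation invariant, since a
  shift by \<open>a\<close> after \<open>B\<close> is a shift by \<open>C *v a\<close> before it. By
  uniqueness it is a multiple of Lebesgue measure.\<close>

lemma nn_integral_lborel_matrix:
  fixes B :: "real^'d^'d"
  assumes "invertible B"
  obtains \<kappa> where "\<And>f. f \<in> borel_measurable borel \<Longrightarrow>
    (\<integral>\<^sup>+x. f (B *v x) \<partial>lborel) = \<kappa> * integral\<^sup>N lborel f"
proof -
  obtain C where C: "B ** C = mat 1" "C ** B = mat 1" using assms by (auto simp: invertible_def)
  define \<mu> where "\<mu> = distr lborel borel ((*v) B)"
  have sets_\<mu>: "sets \<mu> = sets borel" by (simp add: \<mu>_def)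
  have int: "integral\<^sup>N \<mu> h = (\<integral>\<^sup>+x. h (B *v x) \<partial>lborel)" if "h \<in> borel_measurable borel" for h
    using that by (simp add: \<mu>_def nn_integral_distr)
  have inv: "(\<integral>\<^sup>+x. h (x + a) \<partial>\<mu>) = integral\<^sup>N \<mu> h" if h [measurable]: "h \<in> borel_measurable borel" for h a
  proof -
    have "(\<integral>\<^sup>+x. h (x + a) \<partial>\<mu>) = (\<integral>\<^sup>+x. h (B *v x + a) \<partial>lborel)" by (rule int) simp
    also have "\<dots> = (\<integral>\<^sup>+x. h (B *v (C *v a + 1 *\<^sub>R x)) \<partial>lborel)"
      by (simp add: matrix_vector_right_distrib matrix_vector_mul_assoc C add.commute)
    also have "\<dots> = (\<integral>\<^sup>+x. h (B *v x) \<partial>lborel)"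
      by (rule nn_integral_lborel_shift[where f = "\<lambda>x. h (B *v x)"]) auto
    finally show ?thesis by (simp add: int)
  qed
  have sf: "sigma_finite_measure \<mu>"
  proof
    let ?A = "range (\<lambda>n::nat. ball (0 :: real^'d) (real n))"
    have "emeasure \<mu> (ball 0 (real n)) \<noteq> \<infinity>" for n
    proof -
      \<comment> \<open>The preimage of a ball is contained in its image under the inverse, hence is
        bounded and has finite Lebesgue measure.\<close>
      have "(*v) B -` ball 0 (real n) \<subseteq> (*v) C ` ball 0 (real n)"
        by (auto intro!: image_eqI[of _ _ "B *v _"] simp: matrix_vector_mul_assoc C)
      moreover have "bounded ((*v) C ` ball 0 (real n))"
        by (rule bounded_linear_image) auto
      ultimately have "bounded ((*v) B -` ball 0 (real n))" by (rule bounded_subset[rotated])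
      from emeasure_bounded_finite[OF this] show ?thesis
        by (simp add: \<mu>_def emeasure_distr)
    qed
    moreover have "\<Union>?A = UNIV"
      using reals_Archimedean2 by (auto simp: ball_def)
    ultimately show "\<exists>A. countable A \<and> A \<subseteq> sets \<mu> \<and> \<Union> A = space \<mu> \<and> (\<forall>a\<in>A. emeasure \<mu> a \<noteq> \<infinity>)"
      by (intro exI[of _ ?A]) (auto simp: \<mu>_def)
  qed
  show ?thesis
    by (rule that[of "emeasure \<mu> (box 0 One)"])
      (simp add: int[symmetric] nn_integral_translation_invariant[OF sets_\<mu> sf inv])
qed

text \<open>The product form lets integrals factor over coordinates;
  \<open>prod_std_normal_density\<close> supplies the rotation invariant form.\<close>

definition std_gaussian :: "'a::euclidean_space measure" where
  "std_gaussian = density lborel (\<lambda>x. \<Prod>b\<in>Basis. ennreal (std_normal_density (x \<bullet> b)))"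

lemma sets_std_gaussian [simp, measurable_cong]: "sets std_gaussian = sets borel"
  by (simp add: std_gaussian_def)

lemma space_std_gaussian [simp]: "space std_gaussian = UNIV"
  by (simp add: std_gaussian_def)

lemma nn_integral_normal_density: "\<sigma> > 0 \<Longrightarrow> (\<integral>\<^sup>+x. ennreal (normal_density \<mu> \<sigma> x) \<partial>lborel) = 1"
  using prob_space.emeasure_space_1[OF prob_space_normal_density, of \<sigma> \<mu>]
  by (simp add: emeasure_density)

lemma prob_space_std_gaussian: "prob_space (std_gaussian :: 'a::euclidean_space measure)"
proof
  have "emeasure std_gaussian (space (std_gaussian :: 'a measure)) = 
      (\<integral>\<^sup>+x. (\<Prod>b\<in>Basis. ennreal (std_normal_density ((x::'a) \<bullet> b))) \<partial>lborel)"
    by (simp add: std_gaussian_def emeasure_density)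
  also have "\<dots> = 1"
    by (subst nn_integral_lborel_prod) (simp_all add: nn_integral_normal_density)
  finally show "emeasure std_gaussian (space (std_gaussian :: 'a measure)) = 1" .
qed

lemma prod_std_normal_density:
  "(\<Prod>b\<in>Basis. ennreal (std_normal_density ((x::'a::euclidean_space) \<bullet> b)))
    = ennreal (1 / sqrt (2 * pi) ^ DIM('a) * exp (- (x \<bullet> x) / 2))"
proof -
  have "(\<Prod>b\<in>Basis. std_normal_density (x \<bullet> b)) = (1 / sqrt (2 * pi)) ^ DIM('a) * exp (\<Sum>b\<in>Basis. - (x \<bullet> b)\<^sup>2 / 2)"
    by (simp only: std_normal_density_def prod.distrib prod_constant exp_sum[OF finite_Basis])
  also have "(\<Sum>b\<in>Basis. - (x \<bullet> b)\<^sup>2 / 2) = - (x \<bullet> x) / 2"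
    by (subst euclidean_inner[of x x]) (simp add: sum_negf sum_divide_distrib[symmetric] power2_eq_square)
  finally show ?thesis by (simp add: prod_ennreal power_one_over)
qed

text \<open>The volume scaling factor of \<open>B\<close> never has to be computed: it is forced by total mass 1.\<close>

lemma distr_matrix_gaussian:
  fixes B :: "real^'d^'d" and X :: "'w \<Rightarrow> real^'d"
  assumes M: "prob_space M" and B: "invertible B"
    and X: "distributed M lborel X (\<lambda>x. ennreal (c * exp (- ((B *v x) \<bullet> (B *v x)) / 2)))"
  shows "distr M borel (\<lambda>\<omega>. B *v X \<omega>) = std_gaussian"
proof -
  obtain \<kappa> where \<kappa>: "\<And>f. f \<in> borel_measurable borel \<Longrightarrow>
    (\<integral>\<^sup>+x. f (B *v x) \<partial>lborel) = \<kappa> * integral\<^sup>N lborel f"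
    using nn_integral_lborel_matrix[OF B] by blast
  have Xm [measurable]: "X \<in> borel_measurable M" using X by (simp add: distributed_def)
  \<comment> \<open>\<open>E\<close> is the unnormalised Gaussian measure; both laws to be compared
    are constant multiples of it.\<close>
  define E where "E A = (\<integral>\<^sup>+y. ennreal (exp (- (y \<bullet> y) / 2)) * indicator A y \<partial>lborel)" for A :: "(real^'d) set"
  define p where "p = ennreal (1 / sqrt (2 * pi) ^ DIM(real^'d))"
  have std: "emeasure std_gaussian A = p * E A" if [measurable]: "A \<in> sets borel" for A :: "(real^'d) set"
  proof -
    have *: "ennreal (1 / sqrt (2 * pi) ^ DIM(real^'d) * exp (- (y \<bullet> y) / 2)) = p * ennreal (exp (- (y \<bullet> y) / 2))"
      for y :: "real^'d" unfolding p_def by (rule ennreal_mult'') simp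
    have "emeasure std_gaussian A = (\<integral>\<^sup>+y. p * (ennreal (exp (- (y \<bullet> y) / 2)) * indicator A y) \<partial>lborel)"
      unfolding std_gaussian_def prod_std_normal_density *
      by (subst emeasure_density) (simp_all add: mult.assoc)
    then show ?thesis by (simp add: E_def nn_integral_cmult)
  qed
  have BX: "emeasure (distr M borel (\<lambda>\<omega>. B *v X \<omega>)) A = (\<kappa> * ennreal c) * E A"
    if A [measurable]: "A \<in> sets borel" for A
  proof -
    have [measurable]: "(*v) B -` A \<in> sets borel"
      using measurable_sets[OF borel_measurable_matrix_vector_mult A, of B] by simp
    have "distr M borel (\<lambda>\<omega>. B *v X \<omega>) = distr (distr M lborel X) borel ((*v) B)"
      by (subst distr_distr) (auto simp: comp_def)
    also have "\<dots> = distr (density lborel (\<lambda>x. ennreal (c * exp (- ((B *v x) \<bullet> (B *v x)) / 2)))) borel ((*v) B)"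
      using X by (simp add: distributed_def)
    finally have "emeasure (distr M borel (\<lambda>\<omega>. B *v X \<omega>)) A = 
       (\<integral>\<^sup>+x. ennreal (c * exp (- ((B *v x) \<bullet> (B *v x)) / 2)) * indicator A (B *v x) \<partial>lborel)"
      by (simp add: emeasure_distr emeasure_density indicator_def)
    also have "\<dots> = (\<integral>\<^sup>+x. ennreal c * (ennreal (exp (- ((B *v x) \<bullet> (B *v x)) / 2)) * indicator A (B *v x)) \<partial>lborel)"
      by (simp add: ennreal_mult'' mult.assoc)
    also have "\<dots> = \<kappa> * (\<integral>\<^sup>+y. ennreal c * (ennreal (exp (- (y \<bullet> y) / 2)) * indicator A y) \<partial>lborel)"
      by (rule \<kappa>) simp
    also have "\<dots> = (\<kappa> * ennreal c) * E A" by (simp add: E_def nn_integral_cmult mult.assoc)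
    finally show ?thesis .
  qed
  interpret M: prob_space M by fact
  have "emeasure (std_gaussian :: (real^'d) measure) UNIV = 1"
    using prob_space.emeasure_space_1[OF prob_space_std_gaussian] by (metis space_std_gaussian)
  then have 1: "p * E UNIV = 1" by (simp add: std)
  have 2: "(\<kappa> * ennreal c) * E UNIV = 1"
    using BX[of UNIV] prob_space.emeasure_space_1[OF M.prob_space_distr[of "\<lambda>\<omega>. B *v X \<omega>" borel]] by simp
  \<comment> \<open>Cancelling the total mass of \<open>E\<close> requires it to be positive and
    finite; both follow from \<open>p * E UNIV = 1\<close>.\<close>
  have "p \<noteq> 0" "p \<noteq> top" by (simp_all add: p_def)
  then have E: "E UNIV \<noteq> 0" "E UNIV \<noteq> top" using 1 by (auto simp: ennreal_mult_top)
  have "E UNIV * (\<kappa> * ennreal c) = E UNIV * p" using 1 2 by (simp add: mult.commute)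
  then have "\<kappa> * ennreal c = p" unfolding ennreal_mult_cancel_left using E by simp
  then show ?thesis by (intro measure_eqI) (simp_all add: std BX)
qed

lemma distr_std_gaussian_orthogonal:
  fixes Q :: "real^'d^'d"
  assumes Q: "orthogonal_matrix Q"
  shows "distr std_gaussian borel ((*v) Q) = std_gaussian"
proof -
  have "invertible Q" using Q by (auto simp: orthogonal_matrix_def invertible_def)
  moreover have "(Q *v x) \<bullet> (Q *v x) = x \<bullet> x" for x
    using Q orthogonal_transformation_matrix[of "(*v) Q"] by (simp add: orthogonal_transformation_def)
  then have "distributed std_gaussian lborel (\<lambda>x. x)
    (\<lambda>x. ennreal (1 / sqrt (2 * pi) ^ DIM(real^'d) * exp (- ((Q *v x) \<bullet> (Q *v x)) / 2)))"
    unfolding distributed_def by (simp only: prod_std_normal_density[symmetric])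
      (auto simp: std_gaussian_def distr_id2)
  ultimately show ?thesis
    using distr_matrix_gaussian[OF prob_space_std_gaussian] by blast
qed

section \<open>Inverse moments\<close>

text \<open>For positive \<open>r\<close> this is the Laplace integral of \<open>1 / r\<close>. For
  \<open>r = 0\<close> the left side is infinite, and so is the integral of 1 over the half
  line.\<close>

lemma inverse_le_laplace:
  assumes "r \<ge> 0"
  shows "inverse (ennreal r) \<le> (\<integral>\<^sup>+t. ennreal (exp (- (t * r))) * indicator {0..} t \<partial>lborel)"
proof (cases "r = 0")
  case True
  have "ennreal (real n) \<le> emeasure lborel {0::real..}" for n
    using emeasure_mono[of "{0..real n}" "{0..}" lborel] by simp
  then have "emeasure lborel {0::real..} = top"
    by (metis ennreal_of_nat_eq_real_of_nat le_sup_iff neq_top_trans ennreal_Ex_less_of_nat less_top not_le)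
  then show ?thesis using True by simp
next
  case False
  then have r: "r > 0" using assms by simp
  have "(\<integral>\<^sup>+t. ennreal (exp (- (t * r))) * indicator {0..} t \<partial>lborel) = ennreal (0 - (- (exp (- (0 * r)) / r)))"
  proof (rule nn_integral_FTC_atLeast)
    show "((\<lambda>t. - (exp (- (t * r)) / r)) \<longlongrightarrow> 0) at_top" using r by real_asymp
  qed (use r in \<open>auto intro!: derivative_eq_intros\<close>)
  then show ?thesis using r by (simp add: inverse_ennreal inverse_eq_divide)
qed

lemma nn_integral_std_normal_exp_square:
  assumes "t \<ge> 0"
  shows "(\<integral>\<^sup>+x. ennreal (std_normal_density x * exp (- (t * x\<^sup>2))) \<partial>lborel) = ennreal (1 / sqrt (1 + 2 * t))"
proof -
  \<comment> \<open>Completing the Gaussian exponent: the integrand is \<sigma> times the normal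
    density with variance \<open>1 / (1 + 2 * t)\<close>.\<close>
  define \<sigma> where "\<sigma> = 1 / sqrt (1 + 2 * t)"
  have \<sigma>: "\<sigma> > 0" "\<sigma>\<^sup>2 = 1 / (1 + 2 * t)" using assms by (auto simp: \<sigma>_def power_divide)
  have "std_normal_density x * exp (- (t * x\<^sup>2)) = \<sigma> * normal_density 0 \<sigma> x" for x
  proof -
    have "- x\<^sup>2 / (2 * \<sigma>\<^sup>2) = - x\<^sup>2 / 2 + - (t * x\<^sup>2)"
      using assms by (simp add: \<sigma> field_simps)
    then have "exp (- x\<^sup>2 / (2 * \<sigma>\<^sup>2)) = exp (- x\<^sup>2 / 2) * exp (- (t * x\<^sup>2))"
      by (simp only: exp_add)
    moreover have "sqrt (2 * pi * \<sigma>\<^sup>2) = sqrt (2 * pi) * \<sigma>" using \<sigma>(1) by (simp add: real_sqrt_mult)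
    ultimately show ?thesis using \<sigma>(1) by (simp add: normal_density_def)
  qed
  then show ?thesis
    using \<sigma>(1) by (simp add: ennreal_mult nn_integral_cmult nn_integral_normal_density \<sigma>_def[symmetric])
qed

text \<open>This is the Laplace transform of a chi-square variable with \<open>card K\<close>
  degrees of freedom. The integral factors over the coordinates, and those outside \<open>K\<close>
  contribute 1.\<close>

lemma nn_integral_std_gaussian_exp_square:
  fixes K :: "'a::euclidean_space set"
  assumes K: "K \<subseteq> Basis" and t: "t \<ge> 0"
  shows "(\<integral>\<^sup>+x. ennreal (exp (- (t * (\<Sum>b\<in>K. (x \<bullet> b)\<^sup>2)))) \<partial>std_gaussian)
    = ennreal ((1 + 2 * t) powr (- (real (card K) / 2)))"
proof -
  have fin: "finite K" using K finite_Basis finite_subset by blast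
  define f where "f b y = std_normal_density y * (if b \<in> K then exp (- (t * y\<^sup>2)) else 1)" for b :: 'a and y :: real
  have f0: "f b y \<ge> 0" for b y by (simp add: f_def)
  have [measurable]: "f b \<in> borel_measurable borel" for b unfolding f_def by simp
  have fprod: "(\<Prod>b\<in>Basis. ennreal (std_normal_density (x \<bullet> b))) * ennreal (exp (- (t * (\<Sum>b\<in>K. (x \<bullet> b)\<^sup>2))))
     = (\<Prod>b\<in>Basis. ennreal (f b (x \<bullet> b)))" for x :: 'a
  proof -
    have "exp (- (t * (\<Sum>b\<in>K. (x \<bullet> b)\<^sup>2))) = (\<Prod>b\<in>K. exp (- (t * (x \<bullet> b)\<^sup>2)))"
      by (simp add: sum_distrib_left exp_sum[OF fin] sum_negf[symmetric])
    also have "\<dots> = (\<Prod>b\<in>Basis. if b \<in> K then exp (- (t * (x \<bullet> b)\<^sup>2)) else 1)"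
      using K by (simp add: prod.inter_restrict[symmetric] Int_absorb1)
    finally have "(\<Prod>b\<in>Basis. std_normal_density (x \<bullet> b)) * exp (- (t * (\<Sum>b\<in>K. (x \<bullet> b)\<^sup>2))) = (\<Prod>b\<in>Basis. f b (x \<bullet> b))"
      by (simp only: f_def prod.distrib)
    then show ?thesis by (simp add: prod_ennreal f0 ennreal_mult'[symmetric] prod_nonneg)
  qed
  have "(\<integral>\<^sup>+x. ennreal (exp (- (t * (\<Sum>b\<in>K. (x \<bullet> b)\<^sup>2)))) \<partial>std_gaussian)
     = (\<integral>\<^sup>+x. (\<Prod>b\<in>Basis. ennreal (f b (x \<bullet> b))) \<partial>lborel)"
    unfolding std_gaussian_def by (subst nn_integral_density) (auto simp: fprod)
  also have "\<dots> = (\<Prod>b\<in>Basis. \<integral>\<^sup>+y. ennreal (f b y) \<partial>lborel)"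
    by (rule nn_integral_lborel_prod) auto
  also have "\<dots> = (\<Prod>b\<in>Basis. if b \<in> K then ennreal (1 / sqrt (1 + 2 * t)) else 1)"
    by (intro prod.cong) (auto simp: f_def nn_integral_std_normal_exp_square[OF t] nn_integral_normal_density)
  also have "\<dots> = ennreal (1 / sqrt (1 + 2 * t)) ^ card K"
    using K by (simp add: prod.inter_restrict[symmetric] Int_absorb1)
  also have "\<dots> = ennreal ((1 / sqrt (1 + 2 * t)) ^ card K)" using t by (simp add: ennreal_power)
  also have "1 / sqrt (1 + 2 * t) = (1 + 2 * t) powr (- (1 / 2))"
    using t by (simp add: powr_minus powr_half_sqrt inverse_eq_divide)
  also have "\<dots> ^ card K = (1 + 2 * t) powr (- (real (card K) / 2))"
    using t by (subst powr_realpow[symmetric]) (simp_all add: powr_powr)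
  finally show ?thesis .
qed

lemma nn_integral_inverse_chi_square_le:
  fixes K :: "'a::euclidean_space set"
  assumes K: "K \<subseteq> Basis" and card: "card K > 2"
  shows "(\<integral>\<^sup>+x. inverse (ennreal (\<Sum>b\<in>K. (x \<bullet> b)\<^sup>2)) \<partial>std_gaussian) \<le> ennreal (1 / (real (card K) - 2))"
proof -
  interpret std: prob_space "std_gaussian :: 'a measure" by (rule prob_space_std_gaussian)
  interpret pair_sigma_finite "std_gaussian :: 'a measure" "lborel :: real measure" ..
  define k where "k = real (card K)"
  have k: "k > 2" using card by (simp add: k_def)
  let ?S = "\<lambda>x::'a. \<Sum>b\<in>K. (x \<bullet> b)\<^sup>2"
  have "(\<integral>\<^sup>+x. inverse (ennreal (?S x)) \<partial>std_gaussian)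
    \<le> (\<integral>\<^sup>+x. (\<integral>\<^sup>+t. ennreal (exp (- (t * ?S x))) * indicator {0..} t \<partial>lborel) \<partial>std_gaussian)"
    by (intro nn_integral_mono inverse_le_laplace sum_nonneg) auto
  also have "\<dots> = (\<integral>\<^sup>+t. (\<integral>\<^sup>+x. ennreal (exp (- (t * ?S x))) * indicator {0..} t \<partial>std_gaussian) \<partial>lborel)"
    by (rule Fubini'[symmetric]) measurable
  also have "\<dots> = (\<integral>\<^sup>+t. ennreal ((1 + 2 * t) powr (- (k / 2))) * indicator {0..} t \<partial>lborel)"
    by (intro nn_integral_cong)
      (auto simp: indicator_def nn_integral_std_gaussian_exp_square[OF K] k_def)
  \<comment> \<open>The antiderivative has exponent \<open>1 - k / 2\<close>, so it tends to 0 at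
    infinity because \<open>k > 2\<close>.\<close>
  also have "\<dots> = ennreal (0 - (- ((1 + 2 * 0) powr (1 - k / 2) / (k - 2))))"
  proof (rule nn_integral_FTC_atLeast)
    show "((\<lambda>t. - ((1 + 2 * t) powr (1 - k / 2) / (k - 2))) \<longlongrightarrow> 0) at_top" using k by real_asymp
    show "((\<lambda>t. - ((1 + 2 * t) powr (1 - k / 2) / (k - 2))) has_real_derivative
        (1 + 2 * t) powr (- (k / 2))) (at t)" if "0 \<le> t" for t
    proof -
      have "((\<lambda>t. - ((1 + 2 * t) powr (1 - k / 2) / (k - 2))) has_real_derivative
          - ((1 - k / 2) * (1 + 2 * t) powr (1 - k / 2 - 1) * 2 / (k - 2))) (at t)"
        using that k by (auto intro!: derivative_eq_intros)
      moreover have "- ((1 - k / 2) * p * 2 / (k - 2)) = p" for p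
        using k by (simp add: field_simps)
      ultimately show ?thesis by simp
    qed
  qed auto
  finally show ?thesis by (simp add: k_def)
qed

lemma inverse_ennreal_antimono: "a \<le> b \<Longrightarrow> inverse b \<le> inverse (a :: ennreal)"
proof (cases a; cases b)
  fix r s assume *: "0 \<le> r" "a = ennreal r" "0 \<le> s" "b = ennreal s" and "a \<le> b"
  then show ?thesis by (cases "r = 0") (auto simp: inverse_ennreal)
qed (auto simp: top_unique)

text \<open>Rotate so that \<open>CARD('d) - length vs\<close> coordinates are taken along
  directions orthogonal to \<open>vs\<close>. Their sum of squares bounds the squared length of the
  orthogonal component from below, even for dependent \<open>vs\<close>, and the rotated vector is
  again standard Gaussian.\<close>

lemma nn_integral_inverse_perp_part_le:
  fixes vs :: "(real^'d) list"
  assumes len: "length vs + 2 < CARD('d)"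
  shows "(\<integral>\<^sup>+x. inverse (ennreal (perp_part vs x \<bullet> perp_part vs x)) \<partial>std_gaussian)
    \<le> ennreal (1 / (real CARD('d) - real (length vs) - 2))"
proof -
  define W where "W = {u. \<forall>v\<in>span (set vs). orthogonal v u}"
  have W: "subspace W" by (auto simp: W_def subspace_def orthogonal_def inner_add_right)
  have "dim W + dim (span (set vs)) = CARD('d)"
    using dim_subspace_orthogonal_to_vectors[of "span (set vs)" UNIV] by (simp add: W_def)
  moreover have "dim (span (set vs)) \<le> length vs"
    using dim_le_card'[of "set vs"] card_length[of vs] by simp
  ultimately have dimW: "CARD('d) - length vs \<le> dim W" by linarith
  obtain K :: "'d set" where K: "card K = CARD('d) - length vs"
    using obtain_subset_with_card_n[of "CARD('d) - length vs" "UNIV :: 'd set"] by auto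
  obtain Q :: "real^'d^'d" where Q: "orthogonal_matrix Q" "\<And>i. i \<in> K \<Longrightarrow> Q $ i \<in> W"
    using orthogonal_matrix_rows_in_subspace[OF W, of K] K dimW by auto
  define Kb where "Kb = (\<lambda>i. axis i 1 :: real^'d) ` K"
  have inj: "inj_on (\<lambda>i. axis i 1 :: real^'d) K" by (auto simp: inj_on_def axis_eq_axis)
  have Kb: "Kb \<subseteq> Basis" "card Kb = CARD('d) - length vs"
    using K by (auto simp: Kb_def Basis_vec_def card_image[OF inj])
  have row: "(Q *v x) $ i = Q $ i \<bullet> x" for x i
    by (simp add: matrix_vector_mult_def inner_vec_def)
  have le: "(\<Sum>b\<in>Kb. ((Q *v x) \<bullet> b)\<^sup>2) \<le> perp_part vs x \<bullet> perp_part vs x" for x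
  proof -
    let ?z = "perp_part vs x"
    have "(\<Sum>b\<in>Kb. ((Q *v x) \<bullet> b)\<^sup>2) = (\<Sum>i\<in>K. ((Q *v x) $ i)\<^sup>2)"
      by (simp add: Kb_def sum.reindex[OF inj] inner_axis)
    \<comment> \<open>The rows of \<open>Q\<close> indexed by \<open>K\<close> are orthogonal to the
      span of \<open>vs\<close>, so they do not see the difference between \<open>x\<close> and
      \<open>?z\<close>.\<close>
    also have "\<dots> = (\<Sum>i\<in>K. ((Q *v ?z) $ i)\<^sup>2)"
    proof (intro sum.cong refl)
      fix i assume "i \<in> K"
      then have "Q $ i \<bullet> v = 0" if "v \<in> set vs" for v
        using Q(2)[of i] that by (auto simp: W_def orthogonal_def inner_commute intro: span_base)
      from perp_part_inner_eq[OF this, where u = x] show "((Q *v x) $ i)\<^sup>2 = ((Q *v ?z) $ i)\<^sup>2"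
        by (simp add: row)
    qed
    also have "\<dots> \<le> (\<Sum>i\<in>UNIV. ((Q *v ?z) $ i)\<^sup>2)" by (intro sum_mono2) auto
    also have "\<dots> = (Q *v ?z) \<bullet> (Q *v ?z)" by (simp add: inner_vec_def power2_eq_square)
    also have "\<dots> = ?z \<bullet> ?z"
      using Q(1) orthogonal_transformation_matrix[of "(*v) Q"] by (simp add: orthogonal_transformation_def)
    finally show ?thesis .
  qed
  have "(\<integral>\<^sup>+x. inverse (ennreal (perp_part vs x \<bullet> perp_part vs x)) \<partial>std_gaussian)
     \<le> (\<integral>\<^sup>+x. inverse (ennreal (\<Sum>b\<in>Kb. ((Q *v x) \<bullet> b)\<^sup>2)) \<partial>std_gaussian)"
    by (intro nn_integral_mono inverse_ennreal_antimono ennreal_leI le)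
  also have "\<dots> = (\<integral>\<^sup>+x. inverse (ennreal (\<Sum>b\<in>Kb. (x \<bullet> b)\<^sup>2)) \<partial>distr std_gaussian borel ((*v) Q))"
    by (subst nn_integral_distr) auto
  also have "\<dots> = (\<integral>\<^sup>+x. inverse (ennreal (\<Sum>b\<in>Kb. (x \<bullet> b)\<^sup>2)) \<partial>std_gaussian)"
    by (simp only: distr_std_gaussian_orthogonal[OF Q(1)])
  also have "\<dots> \<le> ennreal (1 / (real (card Kb) - 2))"
    using Kb len by (intro nn_integral_inverse_chi_square_le) auto
  finally show ?thesis using len by (simp add: Kb of_nat_diff)
qed

section \<open>Independent Gaussian vectors\<close>

text \<open>The joint law of independent variables is the product of their laws. The tuple is
  restricted to \<open>I\<close> because the product space consists of extensional
  functions.\<close>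

lemma (in prob_space) nn_integral_iid:
  assumes indep: "indep_vars (\<lambda>_. borel) G I" and I: "I \<noteq> {}"
    and distr: "\<And>i. i \<in> I \<Longrightarrow> distr M borel (G i) = N"
    and f: "f \<in> borel_measurable (\<Pi>\<^sub>M i\<in>I. N)"
  shows "(\<integral>\<^sup>+\<omega>. f (\<lambda>i\<in>I. G i \<omega>) \<partial>M) = integral\<^sup>N (\<Pi>\<^sub>M i\<in>I. N) f"
proof -
  have [measurable]: "random_variable borel (G i)" if "i \<in> I" for i
    using indep that by (auto simp: indep_vars_def)
  have "sets N = sets borel" using I distr by (metis ex_in_conv sets_distr)
  then have "sets (\<Pi>\<^sub>M i\<in>I. N) = sets (\<Pi>\<^sub>M i\<in>I. borel)" by (intro sets_PiM_cong) auto
  then have f': "f \<in> borel_measurable (\<Pi>\<^sub>M i\<in>I. borel)" using f by (simp cong: measurable_cong_sets)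
  have meas: "(\<lambda>\<omega>. \<lambda>i\<in>I. G i \<omega>) \<in> measurable M (\<Pi>\<^sub>M i\<in>I. borel)" by measurable
  have "(\<Pi>\<^sub>M i\<in>I. N) = (\<Pi>\<^sub>M i\<in>I. distr M borel (G i))" by (intro PiM_cong) (simp_all add: distr)
  also have "\<dots> = distr M (\<Pi>\<^sub>M i\<in>I. borel) (\<lambda>\<omega>. \<lambda>i\<in>I. G i \<omega>)"
    using indep_vars_iff_distr_eq_PiM'[OF I, where M' = "\<lambda>_. borel" and X = G] indep by simp
  finally show ?thesis using nn_integral_distr[OF meas, of f] f' by simp
qed

definition omit :: "nat \<Rightarrow> nat \<Rightarrow> nat list" where
  "omit n i = filter (\<lambda>j. j \<noteq> i) [0..<n]"

lemma set_omit: "set (omit n i) = {..<n} - {i}"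
  by (auto simp: omit_def)

lemma map_restrict_omit: "map (restrict g {..<n}) (omit n i) = map g (omit n i)"
  by (rule map_cong) (auto simp: set_omit)

lemma length_omit: "i < n \<Longrightarrow> length (omit n i) = n - 1"
  using distinct_card[of "omit n i"] set_omit[of n i] by (simp add: omit_def)

lemma borel_measurable_perp_part_PiM:
  assumes "i < n"
  shows "(\<lambda>g. perp_part (map g (omit n i)) (g i)) \<in>
    borel_measurable (\<Pi>\<^sub>M j\<in>{..<n}. (std_gaussian :: 'a::euclidean_space measure))"
  using assms by (intro borel_measurable_perp_part) (auto simp: set_omit)

text \<open>By Tonelli the vector \<open>g i\<close> is integrated first with the others frozen, and
  the bound for a fixed list is uniform in that list.\<close>

lemma nn_integral_PiM_inverse_perp_part_le:
  assumes i: "i < n" and d: "CARD('d) > n + 1"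
  shows "(\<integral>\<^sup>+g. inverse (ennreal (perp_part (map g (omit n i)) (g i) \<bullet> perp_part (map g (omit n i)) (g i)))
      \<partial>(\<Pi>\<^sub>M j\<in>{..<n}. (std_gaussian :: (real^'d) measure)))
    \<le> ennreal (1 / (real CARD('d) - real n - 1))"
proof -
  let ?N = "std_gaussian :: (real^'d) measure"
  let ?F = "\<lambda>g :: nat \<Rightarrow> real^'d. inverse (ennreal (perp_part (map g (omit n i)) (g i) \<bullet> perp_part (map g (omit n i)) (g i)))"
  interpret N: prob_space ?N by (rule prob_space_std_gaussian)
  interpret product_prob_space "\<lambda>_::nat. ?N" ..
  define J where "J = {..<n} - {i}"
  have J: "finite J" "i \<notin> J" "{..<n} = insert i J" using i by (auto simp: J_def)
  interpret PJ: prob_space "\<Pi>\<^sub>M j\<in>J. ?N" by (rule prob_space_PiM) unfold_locales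
  have [measurable]: "?F \<in> borel_measurable (\<Pi>\<^sub>M j\<in>insert i J. ?N)"
    using borel_measurable_perp_part_PiM[OF i, where 'a = "real^'d"] unfolding J(3)[symmetric] by measurable
  have upd: "map (g(i := y)) (omit n i) = map g (omit n i)" for g :: "nat \<Rightarrow> real^'d" and y
    by (simp add: omit_def)
  have len: "length (map g (omit n i)) + 2 < CARD('d)" for g :: "nat \<Rightarrow> real^'d"
    using i d by (simp add: length_omit)
  have n: "real CARD('d) - real (n - 1) - 2 = real CARD('d) - real n - 1" using i by (simp add: of_nat_diff)
  have "(\<integral>\<^sup>+g. ?F g \<partial>(\<Pi>\<^sub>M j\<in>insert i J. ?N)) = (\<integral>\<^sup>+g. (\<integral>\<^sup>+y. ?F (g(i := y)) \<partial>?N) \<partial>(\<Pi>\<^sub>M j\<in>J. ?N))"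
    by (rule product_nn_integral_insert) (use J in auto)
  also have "\<dots> \<le> (\<integral>\<^sup>+g. ennreal (1 / (real CARD('d) - real n - 1)) \<partial>(\<Pi>\<^sub>M j\<in>J. ?N))"
  proof (intro nn_integral_mono)
    fix g
    show "(\<integral>\<^sup>+y. ?F (g(i := y)) \<partial>?N) \<le> ennreal (1 / (real CARD('d) - real n - 1))"
      using nn_integral_inverse_perp_part_le[OF len[of g]]
      by (simp only: upd length_map length_omit[OF i] n fun_upd_same)
  qed
  also have "\<dots> = ennreal (1 / (real CARD('d) - real n - 1))"
    by (simp add: PJ.emeasure_space_1)
  finally show ?thesis by (simp add: J(3))
qed

lemma indep_vars_matrix:
  fixes G :: "'i \<Rightarrow> 'w \<Rightarrow> real^'d" and Q :: "real^'d^'e"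
  assumes "prob_space M" "prob_space.indep_vars M (\<lambda>_. borel) G I"
  shows "prob_space.indep_vars M (\<lambda>_. borel) (\<lambda>i \<omega>. Q *v G i \<omega>) I"
  by (rule prob_space.indep_vars_compose2[OF assms]) simp

lemma (in prob_space) nn_integral_dual_vec_inner_le:
  fixes G :: "nat \<Rightarrow> 'a \<Rightarrow> real^'d" and u :: "real^'d"
  assumes indep: "indep_vars (\<lambda>_. borel) G {..<n}"
    and distr: "\<And>j. j < n \<Longrightarrow> distr M borel (G j) = std_gaussian"
    and i: "i < n" and d: "CARD('d) > n + 1"
  shows "(\<integral>\<^sup>+\<omega>. ennreal ((dual_vec (map (\<lambda>j. G j \<omega>) (omit n i)) (G i \<omega>) \<bullet> u)\<^sup>2) \<partial>M)
    \<le> ennreal ((u \<bullet> u) / (real CARD('d) * (real CARD('d) - real n - 1)))"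
proof -
  let ?L = "\<Pi>\<^sub>M j\<in>{..<n}. (std_gaussian :: (real^'d) measure)"
  define H where "H g = dual_vec (map g (omit n i)) (g i)" for g :: "nat \<Rightarrow> real^'d"
  have H_restrict: "H (\<lambda>j\<in>{..<n}. g j) = H g" for g
    unfolding H_def using i by (simp add: map_restrict_omit)
  have H_meas [measurable]: "H \<in> borel_measurable ?L"
    using borel_measurable_perp_part_PiM[OF i, where 'a = "real^'d"]
    unfolding H_def[abs_def] dual_vec_def by measurable
  define E where "E v = (\<integral>\<^sup>+g. ennreal ((H g \<bullet> v)\<^sup>2) \<partial>?L)" for v
  \<comment> \<open>\<open>E\<close> depends only on the joint law, so a rotated family
    \<open>G'\<close> yields the same value as \<open>G\<close>.\<close>
  have E_eq: "(\<integral>\<^sup>+\<omega>. ennreal ((H (\<lambda>j. G' j \<omega>) \<bullet> v)\<^sup>2) \<partial>M) = E v"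
    if "indep_vars (\<lambda>_. borel) G' {..<n}" "\<And>j. j < n \<Longrightarrow> distr M borel (G' j) = std_gaussian" for G' v
    using nn_integral_iid[OF that(1), of std_gaussian "\<lambda>g. ennreal ((H g \<bullet> v)\<^sup>2)"] that(2) i
    by (simp add: E_def H_restrict lessThan_empty_iff)
  \<comment> \<open>Rotate all \<open>G j\<close> by an orthogonal map taking \<open>a\<close> to
    \<open>b\<close>: the joint law is unchanged and the dual vector rotates along.\<close>
  have E_norm_1: "E a = E b" if "norm a = 1" "norm b = 1" for a b :: "real^'d"
  proof -
    obtain f where f: "orthogonal_transformation f" "f a = b"
      using orthogonal_transformation_exists_1[OF \<open>norm a = 1\<close> \<open>norm b = 1\<close>] .
    define Q where "Q = matrix f"
    have Q: "orthogonal_matrix Q" "f = (*v) Q"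
      using f(1) orthogonal_transformation_matrix[of f] by (auto simp: Q_def)
    have 1: "E b = (\<integral>\<^sup>+\<omega>. ennreal ((H (\<lambda>j. Q *v G j \<omega>) \<bullet> b)\<^sup>2) \<partial>M)"
    proof (rule E_eq[symmetric])
      show "indep_vars (\<lambda>_. borel) (\<lambda>j \<omega>. Q *v G j \<omega>) {..<n}"
        by (rule indep_vars_matrix[OF prob_space_axioms indep])
      fix j assume j: "j < n"
      have [measurable]: "G j \<in> borel_measurable M" using indep j by (auto simp: indep_vars_def)
      have "distr M borel (\<lambda>\<omega>. Q *v G j \<omega>) = distr (distr M borel (G j)) borel ((*v) Q)"
        by (subst distr_distr) (auto simp: comp_def)
      then show "distr M borel (\<lambda>\<omega>. Q *v G j \<omega>) = std_gaussian"
        by (simp add: distr[OF j] distr_std_gaussian_orthogonal[OF Q(1)])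
    qed
    have "H (\<lambda>j. Q *v G j \<omega>) \<bullet> b = H (\<lambda>j. G j \<omega>) \<bullet> a" for \<omega>
    proof -
      have "H (\<lambda>j. Q *v G j \<omega>) = f (H (\<lambda>j. G j \<omega>))"
        using dual_vec_map[OF f(1), of "map (\<lambda>j. G j \<omega>) (omit n i)"] by (simp add: H_def Q(2) comp_def)
      then show ?thesis using f by (auto simp: orthogonal_transformation_def)
    qed
    then have "(\<integral>\<^sup>+\<omega>. ennreal ((H (\<lambda>j. Q *v G j \<omega>) \<bullet> b)\<^sup>2) \<partial>M)
        = (\<integral>\<^sup>+\<omega>. ennreal ((H (\<lambda>j. G j \<omega>) \<bullet> a)\<^sup>2) \<partial>M)" by simp
    also have "(\<integral>\<^sup>+\<omega>. ennreal ((H (\<lambda>j. G j \<omega>) \<bullet> a)\<^sup>2) \<partial>M) = E a" by (rule E_eq[OF indep distr])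
    finally show ?thesis by (simp add: 1)
  qed
  have E_unit: "E a \<le> ennreal (1 / (real CARD('d) * (real CARD('d) - real n - 1)))"
    if "norm a = 1" for a
  proof -
    \<comment> \<open>All unit vectors give the same value, so \<open>E a\<close> is the average
      over the coordinate axes, whose sum is the mean squared length of \<open>H\<close>.\<close>
    have "of_nat CARD('d) * E a = (\<Sum>k\<in>(UNIV :: 'd set). E (axis k 1))"
      using E_norm_1[OF that, of "axis _ 1"] by simp
    also have "\<dots> = (\<integral>\<^sup>+g. (\<Sum>k\<in>UNIV. ennreal ((H g \<bullet> axis k 1)\<^sup>2)) \<partial>?L)"
      unfolding E_def by (subst nn_integral_sum) auto
    also have "\<dots> = (\<integral>\<^sup>+g. ennreal (H g \<bullet> H g) \<partial>?L)"
    proof -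
      have "(\<Sum>k\<in>UNIV. (v \<bullet> axis k 1)\<^sup>2) = v \<bullet> v" for v :: "real^'d"
        by (subst inner_vec_def[of v v]) (simp add: inner_axis power2_eq_square)
      then show ?thesis by (simp add: sum_ennreal)
    qed
    also have "\<dots> \<le> ennreal (1 / (real CARD('d) - real n - 1))"
      by (rule order_trans[OF nn_integral_mono nn_integral_PiM_inverse_perp_part_le[OF i d]])
        (simp add: H_def inner_dual_vec_le)
    finally have le: "of_nat CARD('d) * E a \<le> ennreal (1 / (real CARD('d) - real n - 1))" .
    have "E a = ennreal (1 / real CARD('d)) * (of_nat CARD('d) * E a)"
      by (simp add: mult.assoc[symmetric] ennreal_of_nat_eq_real_of_nat ennreal_mult[symmetric])
    also have "\<dots> \<le> ennreal (1 / real CARD('d)) * ennreal (1 / (real CARD('d) - real n - 1))"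
      by (intro mult_left_mono le) auto
    also have "\<dots> = ennreal (1 / (real CARD('d) * (real CARD('d) - real n - 1)))"
      using d by (simp add: ennreal_mult[symmetric])
    finally show ?thesis .
  qed
  have "E u \<le> ennreal ((u \<bullet> u) / (real CARD('d) * (real CARD('d) - real n - 1)))"
  proof (cases "u = 0")
    case False
    define a where "a = (1 / norm u) *\<^sub>R u"
    have a: "norm a = 1" "u = norm u *\<^sub>R a" using False by (auto simp: a_def)
    have "(H g \<bullet> u)\<^sup>2 = (u \<bullet> u) * (H g \<bullet> a)\<^sup>2" for g
      by (subst a(2)) (simp add: power_mult_distrib power2_norm_eq_inner)
    then have "E u = ennreal (u \<bullet> u) * E a"
      by (simp add: E_def ennreal_mult nn_integral_cmult)
    also have "\<dots> \<le> ennreal (u \<bullet> u) * ennreal (1 / (real CARD('d) * (real CARD('d) - real n - 1)))"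
      by (intro mult_left_mono E_unit a) auto
    finally show ?thesis using d by (simp add: ennreal_mult[symmetric])
  qed (simp add: E_def)
  moreover have "(\<integral>\<^sup>+\<omega>. ennreal ((H (\<lambda>j. G j \<omega>) \<bullet> u)\<^sup>2) \<partial>M) = E u" by (rule E_eq[OF indep distr])
  ultimately show ?thesis by (simp add: H_def)
qed

text \<open>The reciprocal of the squared length is infinite where the orthogonal component
  vanishes, but its mean is finite.\<close>

lemma (in prob_space) AE_perp_part_neq_0:
  fixes G :: "nat \<Rightarrow> 'a \<Rightarrow> real^'d"
  assumes indep: "indep_vars (\<lambda>_. borel) G {..<n}"
    and distr: "\<And>j. j < n \<Longrightarrow> distr M borel (G j) = std_gaussian"
    and i: "i < n" and d: "CARD('d) > n + 1"
  shows "AE \<omega> in M. perp_part (map (\<lambda>j. G j \<omega>) (omit n i)) (G i \<omega>) \<noteq> 0"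
proof -
  let ?L = "\<Pi>\<^sub>M j\<in>{..<n}. (std_gaussian :: (real^'d) measure)"
  define F where "F g = inverse (ennreal (perp_part (map g (omit n i)) (g i) \<bullet> perp_part (map g (omit n i)) (g i)))"
    for g :: "nat \<Rightarrow> real^'d"
  have F_restrict: "F (\<lambda>j\<in>{..<n}. g j) = F g" for g
    unfolding F_def using i by (simp add: map_restrict_omit)
  have F_meas [measurable]: "F \<in> borel_measurable ?L"
    using borel_measurable_perp_part_PiM[OF i, where 'a = "real^'d"] unfolding F_def[abs_def] by measurable
  have G: "G j \<in> borel_measurable M" if "j < n" for j using indep that by (auto simp: indep_vars_def)
  have [measurable]: "(\<lambda>\<omega>. perp_part (map (\<lambda>j. G j \<omega>) (omit n i)) (G i \<omega>)) \<in> borel_measurable M"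
    by (rule borel_measurable_perp_part) (use G i in \<open>auto simp: set_omit\<close>)
  have "(\<integral>\<^sup>+\<omega>. F (\<lambda>j. G j \<omega>) \<partial>M) = integral\<^sup>N ?L F"
    using nn_integral_iid[OF indep _ _ F_meas] distr i by (simp add: F_restrict lessThan_empty_iff)
  also have "\<dots> \<le> ennreal (1 / (real CARD('d) - real n - 1))"
    using nn_integral_PiM_inverse_perp_part_le[OF i d] by (simp add: F_def[abs_def])
  also have "\<dots> < \<infinity>" by simp
  finally have "AE \<omega> in M. F (\<lambda>j. G j \<omega>) \<noteq> \<infinity>"
    by (intro nn_integral_PInf_AE) (auto simp: F_def)
  then show ?thesis by eventually_elim (auto simp: F_def)
qed

section \<open>Whitening the sample and summing over the columns of the whitening matrix\<close>

theorem theorem7: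
  fixes M :: "'w measure" and \<Sigma> :: "real^'d^'d" and n :: nat
    and X :: "nat \<Rightarrow> 'w \<Rightarrow> real^'d"
  assumes "prob_space M"
    and "pos_def_mat \<Sigma>"
    and "\<And>i. i < n \<Longrightarrow> X i \<in> borel_measurable M"
    and "prob_space.indep_vars M (\<lambda>_. borel) X {..<n}"
    and "\<And>i. i < n \<Longrightarrow> distributed M lborel (X i) (mvn_density \<Sigma>)"
    and "CARD('d) > n + 1"
  shows "(\<integral>\<^sup>+ \<omega>. ennreal (trace (mp_pinv (\<Sum>i<n. outer (X i \<omega>) (X i \<omega>)))) \<partial>M)
          \<le> ennreal (real n / real CARD('d) * trace (matrix_inv \<Sigma>) / (real CARD('d) - real n - 1))"
proof -
  interpret prob_space M by fact
  obtain B :: "real^'d^'d" where B: "B ** \<Sigma> ** transpose B = mat 1"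
    using pos_def_mat_frame[OF assms(2)] .
  \<comment> \<open>One-sided inverses of square matrices are two-sided, so the factors can be moved
    around until \<open>transpose B ** B\<close> appears as the inverse of \<Sigma>.\<close>
  then have "B ** (\<Sigma> ** transpose B) = mat 1" by (simp add: matrix_mul_assoc)
  then have "(\<Sigma> ** transpose B) ** B = mat 1" "invertible B"
    using matrix_left_right_inverse[of B "\<Sigma> ** transpose B"] invertible_right_inverse[of B] by blast+
  then have "\<Sigma> ** (transpose B ** B) = mat 1" "invertible B" by (simp_all add: matrix_mul_assoc)
  then have inv: "matrix_inv \<Sigma> = transpose B ** B" "invertible B"
    using matrix_left_right_inverse by (auto intro!: matrix_inv_eqI)
  define G where "G i \<omega> = B *v X i \<omega>" for i \<omega>
  have quad: "x \<bullet> (matrix_inv \<Sigma> *v x) = (B *v x) \<bullet> (B *v x)" for x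
  proof -
    have "x \<bullet> (transpose B *v (B *v x)) = (transpose B *v (B *v x)) \<bullet> x" by (rule inner_commute)
    also have "\<dots> = (B *v x) \<bullet> (B *v x)" by (simp add: dot_lmul_matrix)
    finally show ?thesis by (simp only: inv matrix_vector_mul_assoc)
  qed
  have indep: "indep_vars (\<lambda>_. borel) G {..<n}"
    unfolding G_def[abs_def] by (rule indep_vars_matrix[OF assms(1,4)])
  have distr: "distr M borel (G i) = std_gaussian" if "i < n" for i
  proof -
    have "distributed M lborel (X i) (\<lambda>x. ennreal (1 / sqrt ((2 * pi) ^ CARD('d) * det \<Sigma>)
        * exp (- ((B *v x) \<bullet> (B *v x)) / 2)))"
      using assms(5)[OF that] unfolding mvn_density_def[abs_def] quad by simp
    from distr_matrix_gaussian[OF assms(1) inv(2) this] show ?thesis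
      unfolding G_def[abs_def] .
  qed
  define h where "h i \<omega> = dual_vec (map (\<lambda>j. G j \<omega>) (omit n i)) (G i \<omega>)" for i \<omega>
  have G_meas: "G j \<in> borel_measurable M" if "j < n" for j using indep that by (auto simp: indep_vars_def)
  have h_meas [measurable]: "h i \<in> borel_measurable M" if "i < n" for i
  proof -
    have [measurable]: "(\<lambda>\<omega>. perp_part (map (\<lambda>j. G j \<omega>) (omit n i)) (G i \<omega>)) \<in> borel_measurable M"
      by (rule borel_measurable_perp_part) (use G_meas that in \<open>auto simp: set_omit\<close>)
    show ?thesis unfolding h_def[abs_def] dual_vec_def by measurable
  qed
  let ?c = "1 / (real CARD('d) * (real CARD('d) - real n - 1))"
  have "AE \<omega> in M. \<forall>i\<in>{..<n}. perp_part (map (\<lambda>j. G j \<omega>) (omit n i)) (G i \<omega>) \<noteq> 0"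
    by (intro AE_finite_allI) (auto intro: AE_perp_part_neq_0[OF indep distr _ assms(6)])
  then have "AE \<omega> in M. ennreal (trace (mp_pinv (\<Sum>i<n. outer (X i \<omega>) (X i \<omega>))))
      \<le> (\<Sum>i<n. \<Sum>k\<in>UNIV. ennreal ((h i \<omega> \<bullet> column k B)\<^sup>2))"
  proof eventually_elim
    fix \<omega> assume nz: "\<forall>i\<in>{..<n}. perp_part (map (\<lambda>j. G j \<omega>) (omit n i)) (G i \<omega>) \<noteq> 0"
    have hG: "h i \<omega> \<bullet> G j \<omega> = (if i = j then 1 else 0)" if "i < n" "j < n" for i j
    proof (cases "i = j")
      case True
      then show ?thesis using dual_vec_inner_self nz that by (auto simp: h_def)
    next
      case False
      then show ?thesis using that by (auto simp: h_def set_omit intro!: dual_vec_orthogonal)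
    qed
    \<comment> \<open>Moving \<open>B\<close> across the inner product turns duality of the
      \<open>h i\<close> to the \<open>G j\<close> into duality of the
      \<open>h i \<omega> v* B\<close> to the \<open>X j\<close>.\<close>
    have "trace (mp_pinv (\<Sum>i<n. outer (X i \<omega>) (X i \<omega>))) \<le> (\<Sum>i<n. (h i \<omega> v* B) \<bullet> (h i \<omega> v* B))"
      by (rule trace_mp_pinv_gram_le) (simp add: dot_lmul_matrix hG G_def[symmetric])
    also have "\<dots> = (\<Sum>i<n. \<Sum>k\<in>UNIV. (h i \<omega> \<bullet> column k B)\<^sup>2)"
      by (simp add: inner_vec_def vector_matrix_mult_def column_def power2_eq_square mult.commute)
    finally show "ennreal (trace (mp_pinv (\<Sum>i<n. outer (X i \<omega>) (X i \<omega>))))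
      \<le> (\<Sum>i<n. \<Sum>k\<in>UNIV. ennreal ((h i \<omega> \<bullet> column k B)\<^sup>2))"
      by (simp add: sum_ennreal sum_nonneg ennreal_leI)
  qed
  then have "(\<integral>\<^sup>+ \<omega>. ennreal (trace (mp_pinv (\<Sum>i<n. outer (X i \<omega>) (X i \<omega>)))) \<partial>M)
    \<le> (\<integral>\<^sup>+ \<omega>. (\<Sum>i<n. \<Sum>k\<in>UNIV. ennreal ((h i \<omega> \<bullet> column k B)\<^sup>2)) \<partial>M)"
    by (rule nn_integral_mono_AE)
  also have "\<dots> = (\<Sum>i<n. \<Sum>k\<in>UNIV. (\<integral>\<^sup>+ \<omega>. ennreal ((h i \<omega> \<bullet> column k B)\<^sup>2) \<partial>M))"
  proof -
    have "(\<lambda>\<omega>. \<Sum>k\<in>UNIV. ennreal ((h i \<omega> \<bullet> column k B)\<^sup>2)) \<in> borel_measurable M" if "i < n" for i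
      using that by measurable
    then have "(\<integral>\<^sup>+ \<omega>. (\<Sum>i<n. \<Sum>k\<in>UNIV. ennreal ((h i \<omega> \<bullet> column k B)\<^sup>2)) \<partial>M)
      = (\<Sum>i<n. \<integral>\<^sup>+ \<omega>. (\<Sum>k\<in>UNIV. ennreal ((h i \<omega> \<bullet> column k B)\<^sup>2)) \<partial>M)"
      by (intro nn_integral_sum) simp
    also have "\<dots> = (\<Sum>i<n. \<Sum>k\<in>UNIV. \<integral>\<^sup>+ \<omega>. ennreal ((h i \<omega> \<bullet> column k B)\<^sup>2) \<partial>M)"
      using h_meas by (intro sum.cong nn_integral_sum) auto
    finally show ?thesis .
  qed
  also have "\<dots> \<le> (\<Sum>i<n. \<Sum>k\<in>UNIV. ennreal ((column k B \<bullet> column k B) * ?c))"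
    using nn_integral_dual_vec_inner_le[OF indep distr _ assms(6)] by (intro sum_mono) (simp add: h_def)
  also have "\<dots> = ennreal (\<Sum>i<n. \<Sum>k\<in>UNIV. (column k B \<bullet> column k B) * ?c)"
    using assms(6) by (simp add: sum_ennreal sum_nonneg del: sum_constant)
  \<comment> \<open>The squared column lengths of \<open>B\<close> are the diagonal entries of
    \<open>transpose B ** B\<close>, the inverse of \<Sigma>.\<close>
  also have "(\<Sum>i<n. \<Sum>k\<in>UNIV. (column k B \<bullet> column k B) * ?c) = real n * (trace (matrix_inv \<Sigma>) * ?c)"
    by (simp add: inv trace_def matrix_matrix_mult_def transpose_def column_def inner_vec_def sum_divide_distrib)
  finally show ?thesis by (simp add: mult_ac)
qed

end
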